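(* Let $R\subset S$ be an FIP integral extension of commutative rings, where $(R,M)$ is a local ring. For each $(R',S')\in[R,{}_S^tR]\times[{}_S^tR,S]$, let $n[R',S']$ be the number of complements of ${}_{S'}^tR'$ in $[R',S']$. Then $$|[R,S]|=\sum_{(R',S')\in[R,{}_S^tR]\times[{}_S^tR,S]}n[R',S'].$$
   Context: All rings are commutative and unital; $\subset$ denotes proper inclusion; a local ring is a ring with a unique maximal ideal (not necessarily Noetherian). $[R,S]$ is the set of all $R$-subalgebras of $S$; $R\subseteq S$ has FIP if $[R,S]$ is finite. An integral extension $R\subseteq B$ is infra-integral if all its residual field extensions $\kappa_R(Q\cap R)\to\kappa_B(Q)$ ($Q\in\mathrm{Spec}(B)$) are isomorphisms. The t-closure ${}_S^tR$ is the greatest $B\in[R,S]$ such that $R\subseteq B$ is infra-integral (equivalently the smallest $B\in[R,S]$ such that $B\subseteq S$ is t-closed, i.e. such that $b\in S$ lies in $B$ whenever $b^2-rb,\,b^3-rb^2\in B$ for some $r\in B$). For an extension $R'\subseteq S'$ and $T\in[R',S']$, a complement of $T$ in $[R',S']$ is an element $U\in[R',S']$ such that $T\cap U=R'$ and $TU=S'$, where $TU$ is the subring generated by $T$ and $U$. *)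

theory Defs
  imports "HOL-Algebra.Polynomials" "HOL-Algebra.QuotRing" "HOL-Algebra.Generated_Rings"
    "HOL-Algebra.Embedded_Algebras"
begin

text \<open>
  An extension of rings \<open>A \<subseteq> B\<close> is given by two subrings \<open>A \<subseteq> B\<close> of an ambient commutative ring
  \<open>S\<close>; the ring structure on \<open>B\<close> is \<open>S\<lparr>carrier := B\<rparr>\<close>.
\<close>

definition local_ring :: "('a, 'm) ring_scheme \<Rightarrow> 'a set \<Rightarrow> bool"
  where "local_ring A M \<longleftrightarrow>
    cring A \<and> maximalideal M A \<and> (\<forall>N. maximalideal N A \<longrightarrow> N = M)"

text \<open>
  The set \<open>[A, B]\<close> of \<open>A\<close>-subalgebras of \<open>B\<close>. (The library's \<^const>\<open>subalgebra\<close> is not used: it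
  requires neither closure under multiplication nor a unit.)
\<close>

definition subalgebras :: "('a, 'm) ring_scheme \<Rightarrow> 'a set \<Rightarrow> 'a set \<Rightarrow> 'a set set"
  where "subalgebras S A B = {T. subcring T S \<and> A \<subseteq> T \<and> T \<subseteq> B}"

definition FIP :: "('a, 'm) ring_scheme \<Rightarrow> 'a set \<Rightarrow> 'a set \<Rightarrow> bool"
  where "FIP S A B \<longleftrightarrow> finite (subalgebras S A B)"

definition integral_ext :: "('a, 'm) ring_scheme \<Rightarrow> 'a set \<Rightarrow> 'a set \<Rightarrow> bool"
  where "integral_ext S A B \<longleftrightarrow> A \<subseteq> B \<and>
    (\<forall>b\<in>B. \<exists>p. set p \<subseteq> A \<and> p \<noteq> [] \<and> lead_coeff p = \<one>\<^bsub>S\<^esub> \<and> ring.eval S p b = \<zero>\<^bsub>S\<^esub>)"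


subsection \<open>Residue fields\<close>

definition frac_rel :: "('a, 'm) ring_scheme \<Rightarrow> (('a \<times> 'a) \<times> ('a \<times> 'a)) set"
  where "frac_rel D = {((a, b), (c, d)).
    a \<in> carrier D \<and> b \<in> carrier D - {\<zero>\<^bsub>D\<^esub>} \<and> c \<in> carrier D \<and> d \<in> carrier D - {\<zero>\<^bsub>D\<^esub>} \<and>
    a \<otimes>\<^bsub>D\<^esub> d = c \<otimes>\<^bsub>D\<^esub> b}"

definition fract :: "('a, 'm) ring_scheme \<Rightarrow> 'a \<Rightarrow> 'a \<Rightarrow> ('a \<times> 'a) set"
  where "fract D a b = frac_rel D `` {(a, b)}"

text \<open>
  The field of fractions of a domain. The unions below run over all representatives of the
  classes involved; by well-definedness all their members are the same class.
\<close>

definition frac_field :: "('a, 'm) ring_scheme \<Rightarrow> ('a \<times> 'a) set ring"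
  where "frac_field D =
    \<lparr>carrier = (carrier D \<times> (carrier D - {\<zero>\<^bsub>D\<^esub>})) // frac_rel D,
     mult = (\<lambda>F G. \<Union>(a, b)\<in>F. \<Union>(c, d)\<in>G. fract D (a \<otimes>\<^bsub>D\<^esub> c) (b \<otimes>\<^bsub>D\<^esub> d)),
     one = fract D \<one>\<^bsub>D\<^esub> \<one>\<^bsub>D\<^esub>,
     zero = fract D \<zero>\<^bsub>D\<^esub> \<one>\<^bsub>D\<^esub>,
     add = (\<lambda>F G. \<Union>(a, b)\<in>F. \<Union>(c, d)\<in>G.
              fract D (a \<otimes>\<^bsub>D\<^esub> d \<oplus>\<^bsub>D\<^esub> c \<otimes>\<^bsub>D\<^esub> b) (b \<otimes>\<^bsub>D\<^esub> d))\<rparr>"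

definition residue_field :: "('a, 'm) ring_scheme \<Rightarrow> 'a set \<Rightarrow> ('a set \<times> 'a set) set ring"
  where "residue_field A P = frac_field (A Quot P)"

text \<open>
  For a prime \<open>Q\<close> of \<open>B\<close> lying over \<open>P = Q \<inter> A\<close>, the map \<open>A/P \<rightarrow> B/Q\<close>, \<open>P + a \<mapsto> Q + a\<close>, and the
  map \<open>\<kappa>\<^sub>A(P) \<rightarrow> \<kappa>\<^sub>B(Q)\<close> that it induces on fraction fields.
\<close>

definition quot_map :: "('a, 'm) ring_scheme \<Rightarrow> 'a set \<Rightarrow> 'a set \<Rightarrow> 'a set \<Rightarrow> 'a set"
  where "quot_map S B Q C = (\<Union>a\<in>C. Q +>\<^bsub>S\<lparr>carrier := B\<rparr>\<^esub> a)"

definition residual_map ::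
    "('a, 'm) ring_scheme \<Rightarrow> 'a set \<Rightarrow> 'a set \<Rightarrow> ('a set \<times> 'a set) set \<Rightarrow> ('a set \<times> 'a set) set"
  where "residual_map S B Q F =
    (\<Union>(C, D)\<in>F. fract (S\<lparr>carrier := B\<rparr> Quot Q) (quot_map S B Q C) (quot_map S B Q D))"

definition infra_integral :: "('a, 'm) ring_scheme \<Rightarrow> 'a set \<Rightarrow> 'a set \<Rightarrow> bool"
  where "infra_integral S A B \<longleftrightarrow> integral_ext S A B \<and>
    (\<forall>Q. primeideal Q (S\<lparr>carrier := B\<rparr>) \<longrightarrow>
       residual_map S B Q \<in> ring_iso (residue_field (S\<lparr>carrier := A\<rparr>) (Q \<inter> A))
                                      (residue_field (S\<lparr>carrier := B\<rparr>) Q))"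

text \<open>The t-closure of \<open>A\<close> in \<open>B\<close>; the greatest element is taken with respect to inclusion.\<close>

definition t_closure :: "('a, 'm) ring_scheme \<Rightarrow> 'a set \<Rightarrow> 'a set \<Rightarrow> 'a set"
  where "t_closure S A B = (GREATEST T. T \<in> subalgebras S A B \<and> infra_integral S A T)"

definition complements :: "('a, 'm) ring_scheme \<Rightarrow> 'a set \<Rightarrow> 'a set \<Rightarrow> 'a set \<Rightarrow> 'a set set"
  where "complements S A B T =
    {U \<in> subalgebras S A B. T \<inter> U = A \<and> generate_ring S (T \<union> U) = B}"


subsection \<open>Well-definedness of fraction fields and residual maps\<close>

context domain
begin

lemma frac_rel_equiv: "equiv (carrier R \<times> (carrier R - {\<zero>})) (frac_rel R)"
proof (rule equivI)
  show "frac_rel R \<subseteq> (carrier R \<times> (carrier R - {\<zero>})) \<times> (carrier R \<times> (carrier R - {\<zero>}))"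
    by (auto simp: frac_rel_def)
  show "refl_on (carrier R \<times> (carrier R - {\<zero>})) (frac_rel R)"
    by (auto simp: frac_rel_def refl_on_def)
  show "sym (frac_rel R)"
    by (auto simp: frac_rel_def sym_def)
  show "trans (frac_rel R)"
  proof (rule transI, clarsimp simp: frac_rel_def)
    fix a b c d e f
    assume c: "a \<in> carrier R" "b \<in> carrier R" "c \<in> carrier R" "d \<in> carrier R"
        "e \<in> carrier R" "f \<in> carrier R" and d0: "d \<noteq> \<zero>"
      and 1: "a \<otimes> d = c \<otimes> b" and 2: "c \<otimes> f = e \<otimes> d"
    have "d \<otimes> (a \<otimes> f) = (a \<otimes> d) \<otimes> f" using c by algebra
    also have "\<dots> = (c \<otimes> f) \<otimes> b" unfolding 1 using c by algebra
    also have "\<dots> = d \<otimes> (e \<otimes> b)" unfolding 2 using c by algebra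
    finally show "a \<otimes> f = e \<otimes> b" using c d0 m_lcancel by simp
  qed
qed

lemma frac_eq_iff:
  assumes "a \<in> carrier R" "b \<in> carrier R - {\<zero>}" "c \<in> carrier R" "d \<in> carrier R - {\<zero>}"
  shows "fract R a b = fract R c d \<longleftrightarrow> a \<otimes> d = c \<otimes> b"
proof -
  have "fract R a b = fract R c d \<longleftrightarrow> ((a, b), (c, d)) \<in> frac_rel R"
    unfolding fract_def using assms by (intro eq_equiv_class_iff[OF frac_rel_equiv]) auto
  thus ?thesis using assms by (auto simp: frac_rel_def)
qed

lemma mem_frac_iff:
  assumes "a \<in> carrier R" "b \<in> carrier R - {\<zero>}"
  shows "p \<in> fract R a b \<longleftrightarrow>
    (\<exists>c d. p = (c, d) \<and> c \<in> carrier R \<and> d \<in> carrier R - {\<zero>} \<and> a \<otimes> d = c \<otimes> b)"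
  using assms by (cases p) (auto simp: fract_def frac_rel_def)

lemma frac_self: "\<lbrakk>a \<in> carrier R; b \<in> carrier R - {\<zero>}\<rbrakk> \<Longrightarrow> (a, b) \<in> fract R a b"
  by (auto simp: mem_frac_iff)

lemma frac_field_carrier:
  "carrier (frac_field R) = {fract R a b | a b. a \<in> carrier R \<and> b \<in> carrier R - {\<zero>}}"
  unfolding frac_field_def quotient_def fract_def by auto

lemma fract_closed: "\<lbrakk>a \<in> carrier R; b \<in> carrier R - {\<zero>}\<rbrakk> \<Longrightarrow> fract R a b \<in> carrier (frac_field R)"
  by (auto simp: frac_field_carrier)

lemma UN_frac:
  assumes "a \<in> carrier R" "b \<in> carrier R - {\<zero>}"
    and "\<And>c d. \<lbrakk>c \<in> carrier R; d \<in> carrier R - {\<zero>}; a \<otimes> d = c \<otimes> b\<rbrakk> \<Longrightarrow> g c d = Z"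
  shows "(\<Union>(c, d)\<in>fract R a b. g c d) = Z"
proof -
  have "g c d = Z" if "(c, d) \<in> fract R a b" for c d
    using that assms by (simp add: mem_frac_iff)
  thus ?thesis using frac_self[OF assms(1,2)] by fast
qed

lemma frac_field_mult:
  assumes "a \<in> carrier R" "b \<in> carrier R - {\<zero>}" "c \<in> carrier R" "d \<in> carrier R - {\<zero>}"
  shows "fract R a b \<otimes>\<^bsub>frac_field R\<^esub> fract R c d = fract R (a \<otimes> c) (b \<otimes> d)"
proof -
  have "fract R (a' \<otimes> c') (b' \<otimes> d') = fract R (a \<otimes> c) (b \<otimes> d)"
    if x: "a' \<in> carrier R" "b' \<in> carrier R - {\<zero>}" "a \<otimes> b' = a' \<otimes> b"
      "c' \<in> carrier R" "d' \<in> carrier R - {\<zero>}" "c \<otimes> d' = c' \<otimes> d" for a' b' c' d'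
  proof (subst frac_eq_iff)
    have "(a' \<otimes> c') \<otimes> (b \<otimes> d) = (a' \<otimes> b) \<otimes> (c' \<otimes> d)"
      using assms x(1,2,4,5) by (simp add: m_ac)
    also have "\<dots> = (a \<otimes> b') \<otimes> (c \<otimes> d')" using x by simp
    also have "\<dots> = (a \<otimes> c) \<otimes> (b' \<otimes> d')" using assms x(1,2,4,5) by (simp add: m_ac)
    finally show "(a' \<otimes> c') \<otimes> (b \<otimes> d) = (a \<otimes> c) \<otimes> (b' \<otimes> d')" .
  qed (use assms x in \<open>auto simp: integral_iff\<close>)
  note eq = this
  show ?thesis unfolding frac_field_def ring.simps monoid.simps
    by (rule UN_frac[OF assms(1,2)], rule UN_frac[OF assms(3,4)], rule eq)
qed

lemma frac_field_add:
  assumes "a \<in> carrier R" "b \<in> carrier R - {\<zero>}" "c \<in> carrier R" "d \<in> carrier R - {\<zero>}"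
  shows "fract R a b \<oplus>\<^bsub>frac_field R\<^esub> fract R c d = fract R (a \<otimes> d \<oplus> c \<otimes> b) (b \<otimes> d)"
proof -
  have "fract R (a' \<otimes> d' \<oplus> c' \<otimes> b') (b' \<otimes> d') = fract R (a \<otimes> d \<oplus> c \<otimes> b) (b \<otimes> d)"
    if x: "a' \<in> carrier R" "b' \<in> carrier R - {\<zero>}" "a \<otimes> b' = a' \<otimes> b"
      "c' \<in> carrier R" "d' \<in> carrier R - {\<zero>}" "c \<otimes> d' = c' \<otimes> d" for a' b' c' d'
  proof (subst frac_eq_iff)
    have "(a' \<otimes> d' \<oplus> c' \<otimes> b') \<otimes> (b \<otimes> d) = (a' \<otimes> b) \<otimes> (d \<otimes> d') \<oplus> (c' \<otimes> d) \<otimes> (b \<otimes> b')"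
      using assms x(1,2,4,5) by (simp add: m_ac l_distr r_distr)
    also have "\<dots> = (a \<otimes> b') \<otimes> (d \<otimes> d') \<oplus> (c \<otimes> d') \<otimes> (b \<otimes> b')" using x by simp
    also have "\<dots> = (a \<otimes> d \<oplus> c \<otimes> b) \<otimes> (b' \<otimes> d')"
      using assms x(1,2,4,5) by (simp add: m_ac l_distr r_distr)
    finally show "(a' \<otimes> d' \<oplus> c' \<otimes> b') \<otimes> (b \<otimes> d) = (a \<otimes> d \<oplus> c \<otimes> b) \<otimes> (b' \<otimes> d')" .
  qed (use assms x in \<open>auto simp: integral_iff\<close>)
  note eq = this
  show ?thesis unfolding frac_field_def ring.simps monoid.simps
    by (rule UN_frac[OF assms(1,2)], rule UN_frac[OF assms(3,4)], rule eq)
qed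

lemma frac_field_one: "\<one>\<^bsub>frac_field R\<^esub> = fract R \<one> \<one>"
  and frac_field_zero: "\<zero>\<^bsub>frac_field R\<^esub> = fract R \<zero> \<one>"
  by (simp_all add: frac_field_def)

lemma frac_field_is_field: "field (frac_field R)"
proof (rule cring.cring_fieldI2)
  note S = frac_field_carrier frac_field_one frac_field_zero frac_field_mult frac_field_add
    frac_eq_iff integral_iff
  show "cring (frac_field R)"
  proof (intro cringI abelian_groupI comm_monoidI)
    fix x assume "x \<in> carrier (frac_field R)"
    then obtain a b where x: "x = fract R a b" "a \<in> carrier R" "b \<in> carrier R - {\<zero>}"
      by (auto simp: frac_field_carrier)
    show "\<exists>y\<in>carrier (frac_field R). y \<oplus>\<^bsub>frac_field R\<^esub> x = \<zero>\<^bsub>frac_field R\<^esub>"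
    proof (rule bexI)
      show "fract R (\<ominus> a) b \<oplus>\<^bsub>frac_field R\<^esub> x = \<zero>\<^bsub>frac_field R\<^esub>"
        using x by (simp add: S l_minus l_neg)
      show "fract R (\<ominus> a) b \<in> carrier (frac_field R)"
        using x by (simp add: fract_closed)
    qed
  next
    fix x y z
    assume xyz: "x \<in> carrier (frac_field R)" "y \<in> carrier (frac_field R)" "z \<in> carrier (frac_field R)"
    then obtain a b c d e f where x: "x = fract R a b" "a \<in> carrier R" "b \<in> carrier R - {\<zero>}"
      "y = fract R c d" "c \<in> carrier R" "d \<in> carrier R - {\<zero>}"
      "z = fract R e f" "e \<in> carrier R" "f \<in> carrier R - {\<zero>}"
      unfolding frac_field_carrier by blast
    have nz: "b \<otimes> d \<in> carrier R - {\<zero>}" "d \<otimes> f \<in> carrier R - {\<zero>}" "b \<otimes> f \<in> carrier R - {\<zero>}"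
      using x by (simp_all add: integral_iff)
    show "x \<oplus>\<^bsub>frac_field R\<^esub> y \<oplus>\<^bsub>frac_field R\<^esub> z = x \<oplus>\<^bsub>frac_field R\<^esub> (y \<oplus>\<^bsub>frac_field R\<^esub> z)"
      using x nz by (simp add: frac_field_add) (simp add: l_distr r_distr m_ac a_ac)
    show "(x \<oplus>\<^bsub>frac_field R\<^esub> y) \<otimes>\<^bsub>frac_field R\<^esub> z
        = x \<otimes>\<^bsub>frac_field R\<^esub> z \<oplus>\<^bsub>frac_field R\<^esub> y \<otimes>\<^bsub>frac_field R\<^esub> z"
    proof -
      have "fract R ((a \<otimes> d \<oplus> c \<otimes> b) \<otimes> e) ((b \<otimes> d) \<otimes> f) =
        fract R ((a \<otimes> e) \<otimes> (d \<otimes> f) \<oplus> (c \<otimes> e) \<otimes> (b \<otimes> f)) ((b \<otimes> f) \<otimes> (d \<otimes> f))"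
      proof (subst frac_eq_iff)
        have c: "a \<in> carrier R" "b \<in> carrier R" "c \<in> carrier R" "d \<in> carrier R" "e \<in> carrier R" "f \<in> carrier R"
          using x by auto
        show "((a \<otimes> d \<oplus> c \<otimes> b) \<otimes> e) \<otimes> ((b \<otimes> f) \<otimes> (d \<otimes> f)) =
          ((a \<otimes> e) \<otimes> (d \<otimes> f) \<oplus> (c \<otimes> e) \<otimes> (b \<otimes> f)) \<otimes> ((b \<otimes> d) \<otimes> f)"
          using c by algebra
      qed (use x nz in \<open>auto simp: integral_iff\<close>)
      thus ?thesis using x nz by (simp add: frac_field_add frac_field_mult)
    qed
    show "x \<otimes>\<^bsub>frac_field R\<^esub> y \<otimes>\<^bsub>frac_field R\<^esub> z = x \<otimes>\<^bsub>frac_field R\<^esub> (y \<otimes>\<^bsub>frac_field R\<^esub> z)"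
      using x nz by (simp add: frac_field_mult) (simp add: m_ac)
  next
    fix x y
    assume "x \<in> carrier (frac_field R)" "y \<in> carrier (frac_field R)"
    then obtain a b c d where x: "x = fract R a b" "a \<in> carrier R" "b \<in> carrier R - {\<zero>}"
      "y = fract R c d" "c \<in> carrier R" "d \<in> carrier R - {\<zero>}"
      unfolding frac_field_carrier by blast
    have bd: "b \<otimes> d \<in> carrier R - {\<zero>}" using x by (simp add: integral_iff)
    show "x \<oplus>\<^bsub>frac_field R\<^esub> y \<in> carrier (frac_field R)"
      using x bd by (simp add: frac_field_add fract_closed)
    show "x \<otimes>\<^bsub>frac_field R\<^esub> y \<in> carrier (frac_field R)"
      using x bd by (simp add: frac_field_mult fract_closed)
    show "x \<oplus>\<^bsub>frac_field R\<^esub> y = y \<oplus>\<^bsub>frac_field R\<^esub> x"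
      using x by (simp add: frac_field_add) (simp add: m_ac a_ac)
    show "x \<otimes>\<^bsub>frac_field R\<^esub> y = y \<otimes>\<^bsub>frac_field R\<^esub> x"
      using x by (simp add: frac_field_mult) (simp add: m_ac)
  next
    show "\<zero>\<^bsub>frac_field R\<^esub> \<in> carrier (frac_field R)" "\<one>\<^bsub>frac_field R\<^esub> \<in> carrier (frac_field R)"
      by (simp_all add: fract_closed frac_field_one frac_field_zero)
  next
    fix x assume "x \<in> carrier (frac_field R)"
    then obtain a b where x: "x = fract R a b" "a \<in> carrier R" "b \<in> carrier R - {\<zero>}"
      by (auto simp: frac_field_carrier)
    show "\<zero>\<^bsub>frac_field R\<^esub> \<oplus>\<^bsub>frac_field R\<^esub> x = x" "\<one>\<^bsub>frac_field R\<^esub> \<otimes>\<^bsub>frac_field R\<^esub> x = x"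
      using x by (simp_all add: S)
  qed
  show "\<zero>\<^bsub>frac_field R\<^esub> \<noteq> \<one>\<^bsub>frac_field R\<^esub>" by (simp add: S)
  fix x assume "x \<in> carrier (frac_field R)" and x0: "x \<noteq> \<zero>\<^bsub>frac_field R\<^esub>"
  then obtain a b where ab: "x = fract R a b" "a \<in> carrier R" "b \<in> carrier R - {\<zero>}"
    unfolding frac_field_carrier by blast
  hence x: "x = fract R a b" "a \<in> carrier R - {\<zero>}" "b \<in> carrier R - {\<zero>}"
    using x0 by (auto simp: frac_field_zero frac_eq_iff)
  show "\<exists>y\<in>carrier (frac_field R). x \<otimes>\<^bsub>frac_field R\<^esub> y = \<one>\<^bsub>frac_field R\<^esub>"
  proof (rule bexI)
    show "x \<otimes>\<^bsub>frac_field R\<^esub> fract R b a = \<one>\<^bsub>frac_field R\<^esub>"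
      using x by (simp add: S m_comm)
    show "fract R b a \<in> carrier (frac_field R)" using x by (simp add: fract_closed)
  qed
qed

end


lemma (in cring) contracted_prime:
  assumes A: "subcring A R" and B: "subcring B R" and AB: "A \<subseteq> B"
    and Q: "primeideal Q (R\<lparr>carrier := B\<rparr>)"
  shows "primeideal (Q \<inter> A) (R\<lparr>carrier := A\<rparr>)"
proof -
  interpret a: cring "R\<lparr>carrier := A\<rparr>"
    using subcring_iff[OF subcringE(1)[OF A]] A by simp
  interpret b: cring "R\<lparr>carrier := B\<rparr>"
    using subcring_iff[OF subcringE(1)[OF B]] B by simp
  interpret h: ring_hom_ring "R\<lparr>carrier := A\<rparr>" "R\<lparr>carrier := B\<rparr>" id
    by (rule ring_hom_ringI2) (use AB a.ring_axioms b.ring_axioms in \<open>auto simp: ring_hom_def\<close>)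
  have "Q \<inter> A = {r \<in> carrier (R\<lparr>carrier := A\<rparr>). id r \<in> Q}" by auto
  thus ?thesis using h.primeideal_vimage[OF a.is_cring Q] by simp
qed

lemma (in cring) quot_map_rcos:
  assumes A: "subcring A R" and B: "subcring B R" and AB: "A \<subseteq> B"
    and Q: "primeideal Q (R\<lparr>carrier := B\<rparr>)" and a: "a \<in> A"
  shows "quot_map R B Q ((Q \<inter> A) +>\<^bsub>R\<lparr>carrier := A\<rparr>\<^esub> a) = Q +>\<^bsub>R\<lparr>carrier := B\<rparr>\<^esub> a"
proof -
  interpret q: primeideal Q "R\<lparr>carrier := B\<rparr>" by (rule Q)
  interpret p: primeideal "Q \<inter> A" "R\<lparr>carrier := A\<rparr>" by (rule contracted_prime[OF A B AB Q])
  have "Q +>\<^bsub>R\<lparr>carrier := B\<rparr>\<^esub> x = Q +>\<^bsub>R\<lparr>carrier := B\<rparr>\<^esub> a"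
    if x: "x \<in> (Q \<inter> A) +>\<^bsub>R\<lparr>carrier := A\<rparr>\<^esub> a" for x
  proof -
    from x obtain p where p: "p \<in> Q" "p \<in> A" "x = p \<oplus> a"
      by (auto simp: a_r_coset_def')
    have "x \<in> Q +>\<^bsub>R\<lparr>carrier := B\<rparr>\<^esub> a" using p by (auto simp: a_r_coset_def')
    thus ?thesis using q.a_repr_independence'[of x a] a AB by auto
  qed
  moreover have "a \<in> (Q \<inter> A) +>\<^bsub>R\<lparr>carrier := A\<rparr>\<^esub> a"
    using p.a_rcos_self a by simp
  ultimately show ?thesis unfolding quot_map_def by blast
qed

lemma (in cring) residual_map_fract:
  assumes A: "subcring A R" and B: "subcring B R" and AB: "A \<subseteq> B"
    and Q: "primeideal Q (R\<lparr>carrier := B\<rparr>)" and a: "a \<in> A" and s: "s \<in> A - Q"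
  shows "residual_map R B Q (fract (R\<lparr>carrier := A\<rparr> Quot (Q \<inter> A))
      ((Q \<inter> A) +>\<^bsub>R\<lparr>carrier := A\<rparr>\<^esub> a) ((Q \<inter> A) +>\<^bsub>R\<lparr>carrier := A\<rparr>\<^esub> s)) =
    fract (R\<lparr>carrier := B\<rparr> Quot Q) (Q +>\<^bsub>R\<lparr>carrier := B\<rparr>\<^esub> a) (Q +>\<^bsub>R\<lparr>carrier := B\<rparr>\<^esub> s)"
proof -
  let ?A = "R\<lparr>carrier := A\<rparr>" and ?B = "R\<lparr>carrier := B\<rparr>" and ?P = "Q \<inter> A"
  interpret q: primeideal Q ?B by (rule Q)
  interpret p: primeideal ?P ?A by (rule contracted_prime[OF A B AB Q])
  interpret pd: domain "?A Quot ?P" by (rule p.quotient_is_domain)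
  interpret qd: domain "?B Quot Q" by (rule q.quotient_is_domain)
  note qm = quot_map_rcos[OF A B AB Q]
  have cA: "?P +>\<^bsub>?A\<^esub> x \<in> carrier (?A Quot ?P)" if "x \<in> A" for x
    using that by (auto simp: FactRing_def A_RCOSETS_def' a_r_coset_def')
  have cB: "Q +>\<^bsub>?B\<^esub> x \<in> carrier (?B Quot Q)" if "x \<in> B" for x
    using that by (auto simp: FactRing_def A_RCOSETS_def' a_r_coset_def')
  have zA: "?P +>\<^bsub>?A\<^esub> x = \<zero>\<^bsub>?A Quot ?P\<^esub> \<longleftrightarrow> x \<in> ?P" if "x \<in> A" for x
    using that p.a_rcos_self[of x] p.a_rcos_const[of x] by (auto simp: FactRing_def)
  have zB: "Q +>\<^bsub>?B\<^esub> x = \<zero>\<^bsub>?B Quot Q\<^esub> \<longleftrightarrow> x \<in> Q" if "x \<in> B" for x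
    using that q.a_rcos_self[of x] q.a_rcos_const[of x] by (auto simp: FactRing_def)
  have mA: "(?P +>\<^bsub>?A\<^esub> x) \<otimes>\<^bsub>?A Quot ?P\<^esub> (?P +>\<^bsub>?A\<^esub> y) = ?P +>\<^bsub>?A\<^esub> (x \<otimes> y)"
    if "x \<in> A" "y \<in> A" for x y
    using that p.rcoset_mult_add[of x y] by (simp add: FactRing_def)
  have mB: "(Q +>\<^bsub>?B\<^esub> x) \<otimes>\<^bsub>?B Quot Q\<^esub> (Q +>\<^bsub>?B\<^esub> y) = Q +>\<^bsub>?B\<^esub> (x \<otimes> y)"
    if "x \<in> B" "y \<in> B" for x y
    using that q.rcoset_mult_add[of x y] by (simp add: FactRing_def)
  show ?thesis unfolding residual_map_def
  proof (rule pd.UN_frac)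
    show "?P +>\<^bsub>?A\<^esub> a \<in> carrier (?A Quot ?P)" using cA a .
    show "?P +>\<^bsub>?A\<^esub> s \<in> carrier (?A Quot ?P) - {\<zero>\<^bsub>?A Quot ?P\<^esub>}"
      using cA zA s by simp
    fix C D
    assume C: "C \<in> carrier (?A Quot ?P)" and D: "D \<in> carrier (?A Quot ?P) - {\<zero>\<^bsub>?A Quot ?P\<^esub>}"
      and eq: "(?P +>\<^bsub>?A\<^esub> a) \<otimes>\<^bsub>?A Quot ?P\<^esub> D = C \<otimes>\<^bsub>?A Quot ?P\<^esub> (?P +>\<^bsub>?A\<^esub> s)"
    obtain c where c: "c \<in> A" "C = ?P +>\<^bsub>?A\<^esub> c" using C by (auto simp: FactRing_def A_RCOSETS_def' a_r_coset_def')
    obtain d where d: "d \<in> A" "D = ?P +>\<^bsub>?A\<^esub> d" using D by (auto simp: FactRing_def A_RCOSETS_def' a_r_coset_def')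
    have dQ: "d \<notin> Q" using D d zA by auto
    have cl: "c \<otimes> s \<in> A" "a \<otimes> d \<in> A" using a s c d subcringE(6)[OF A] by auto
    have "?P +>\<^bsub>?A\<^esub> (a \<otimes> d) = ?P +>\<^bsub>?A\<^esub> (c \<otimes> s)"
      using eq a s c d by (simp add: mA)
    hence "Q +>\<^bsub>?B\<^esub> (a \<otimes> d) = Q +>\<^bsub>?B\<^esub> (c \<otimes> s)"
      using qm[OF cl(1)] qm[OF cl(2)] by simp
    moreover have "a \<in> B" "c \<in> B" "d \<in> B" "s \<in> B" using a s c d AB by auto
    ultimately show "fract (?B Quot Q) (quot_map R B Q C) (quot_map R B Q D) =
        fract (?B Quot Q) (Q +>\<^bsub>?B\<^esub> a) (Q +>\<^bsub>?B\<^esub> s)"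
      using a s c d dQ by (simp add: qd.frac_eq_iff qm cB zB mB)
  qed
qed

end

theory Submission
  imports Defs
begin

text \<open>
  Write \<open>T\<close> for the t-closure of \<open>R\<close> in \<open>S\<close>. The interval \<open>[R, S]\<close> is partitioned by the fibres of
  \<open>U \<mapsto> (U \<inter> T, TU)\<close>, and the fibre over \<open>(R', S')\<close> consists of the complements of \<open>T\<close> in
  \<open>[R', S']\<close>; so it suffices that \<open>T\<close> is also the t-closure of \<open>R'\<close> in \<open>S'\<close>.

  An integral extension \<open>A \<subseteq> B\<close> is infra-integral iff modulo every prime \<open>Q\<close> of \<open>B\<close> each element of
  \<open>B\<close> is a fraction of elements of \<open>A\<close>. Those elements of \<open>B\<close> that are such fractions modulo a fixed
  \<open>Q\<close> form a subring. Hence if \<open>R \<subseteq> R' \<subseteq> T\<close>, \<open>R \<subseteq> T\<close> is infra-integral and \<open>R' \<subseteq> B\<close> is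
  infra-integral, then so is \<open>R \<subseteq> TB\<close>. For \<open>R' = R\<close> this says that the infra-integral subalgebras are
  directed, so that the t-closure exists; in general it gives \<open>B \<subseteq> T\<close>.
\<close>

section \<open>Arithmetic of cosets modulo a prime ideal\<close>

lemma (in primeideal) rcos_closed [simp]: "a \<in> carrier R \<Longrightarrow> I +> a \<in> carrier (R Quot I)"
  by (auto simp: FactRing_def A_RCOSETS_def' a_r_coset_def')

lemma (in primeideal) rcos_cases:
  assumes "C \<in> carrier (R Quot I)"
  obtains a where "a \<in> carrier R" "C = I +> a"
  using assms by (auto simp: FactRing_def A_RCOSETS_def' a_r_coset_def')

lemma (in primeideal) rcos_eq_zero_iff [simp]:
  "a \<in> carrier R \<Longrightarrow> I +> a = \<zero>\<^bsub>R Quot I\<^esub> \<longleftrightarrow> a \<in> I"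
  using a_rcos_self[of a] a_rcos_const[of a] by (auto simp: FactRing_def)

lemma (in primeideal) rcos_mult:
  "\<lbrakk>a \<in> carrier R; b \<in> carrier R\<rbrakk> \<Longrightarrow> (I +> a) \<otimes>\<^bsub>R Quot I\<^esub> (I +> b) = I +> (a \<otimes> b)"
  using rcoset_mult_add[of a b] by (simp add: FactRing_def)

lemma (in primeideal) rcos_add:
  "\<lbrakk>a \<in> carrier R; b \<in> carrier R\<rbrakk> \<Longrightarrow> (I +> a) \<oplus>\<^bsub>R Quot I\<^esub> (I +> b) = I +> (a \<oplus> b)"
  using a_rcos_sum[of a b] by (simp add: FactRing_def)

lemma (in primeideal) mult_notin: "\<lbrakk>s \<in> carrier R - I; t \<in> carrier R - I\<rbrakk> \<Longrightarrow> s \<otimes> t \<in> carrier R - I"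
  using I_prime by auto

lemma (in primeideal) one_notin: "\<one> \<notin> I"
  using I_notcarr one_imp_carrier by auto

section \<open>Residue fields in terms of representatives\<close>

text \<open>The element \<open>a/s\<close> of the residue field at \<open>P\<close>, named by
  elements of \<open>A\<close> rather than by cosets, so that computations can take place in
  \<open>A\<close> itself.\<close>

definition residue_fract :: "('a, 'm) ring_scheme \<Rightarrow> 'a set \<Rightarrow> 'a \<Rightarrow> 'a \<Rightarrow> ('a set \<times> 'a set) set"
  where "residue_fract A P a s = fract (A Quot P) (P +>\<^bsub>A\<^esub> a) (P +>\<^bsub>A\<^esub> s)"

context primeideal
begin

lemma residue_fract_closed [simp]:
  "\<lbrakk>a \<in> carrier R; s \<in> carrier R - I\<rbrakk> \<Longrightarrow> residue_fract R I a s \<in> carrier (residue_field R I)"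
  using domain.fract_closed[OF quotient_is_domain, of "I +> a" "I +> s"]
  by (simp add: residue_fract_def residue_field_def)

lemma residue_field_cases:
  assumes "F \<in> carrier (residue_field R I)"
  obtains a s where "a \<in> carrier R" "s \<in> carrier R - I" "F = residue_fract R I a s"
proof -
  from assms obtain C D where F: "F = fract (R Quot I) C D"
    and C: "C \<in> carrier (R Quot I)" and D: "D \<in> carrier (R Quot I)" "D \<noteq> \<zero>\<^bsub>R Quot I\<^esub>"
    by (auto simp: residue_field_def domain.frac_field_carrier[OF quotient_is_domain])
  from rcos_cases[OF C] obtain a where a: "a \<in> carrier R" "C = I +> a" .
  from rcos_cases[OF D(1)] obtain s where s: "s \<in> carrier R" "D = I +> s" .
  show ?thesis
    by (rule that[of a s]) (use a s D F in \<open>auto simp: residue_fract_def\<close>)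
qed

lemma residue_fract_eq_iff:
  assumes "a \<in> carrier R" "s \<in> carrier R - I" "b \<in> carrier R" "t \<in> carrier R - I"
  shows "residue_fract R I a s = residue_fract R I b t \<longleftrightarrow> I +> (a \<otimes> t) = I +> (b \<otimes> s)"
  using assms by (simp add: residue_fract_def domain.frac_eq_iff[OF quotient_is_domain] rcos_mult)

lemma residue_field_mult:
  assumes "a \<in> carrier R" "s \<in> carrier R - I" "b \<in> carrier R" "t \<in> carrier R - I"
  shows "residue_fract R I a s \<otimes>\<^bsub>residue_field R I\<^esub> residue_fract R I b t =
    residue_fract R I (a \<otimes> b) (s \<otimes> t)"
  using assms by (simp add: residue_fract_def residue_field_def
      domain.frac_field_mult[OF quotient_is_domain] rcos_mult)

lemma residue_field_add:
  assumes "a \<in> carrier R" "s \<in> carrier R - I" "b \<in> carrier R" "t \<in> carrier R - I"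
  shows "residue_fract R I a s \<oplus>\<^bsub>residue_field R I\<^esub> residue_fract R I b t =
    residue_fract R I (a \<otimes> t \<oplus> b \<otimes> s) (s \<otimes> t)"
  using assms by (simp add: residue_fract_def residue_field_def
      domain.frac_field_add[OF quotient_is_domain] rcos_mult rcos_add)

lemma residue_field_one: "\<one>\<^bsub>residue_field R I\<^esub> = residue_fract R I \<one> \<one>"
  by (simp add: residue_fract_def residue_field_def domain.frac_field_one[OF quotient_is_domain])
    (simp add: FactRing_def)

end

section \<open>Elements of an overring that are fractions of base elements modulo a prime\<close>

text \<open>For a prime \<open>Q\<close> of \<open>B\<close>, this is the preimage in
  \<open>B\<close> of the image of the residue field of \<open>A\<close> at
  \<open>Q \<inter> A\<close> inside the residue field of \<open>B\<close> at \<open>Q\<close>; the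
  equation \<open>x = a/s\<close> is stated with its denominator cleared.\<close>

definition residual_fractions :: "('a, 'm) ring_scheme \<Rightarrow> 'a set \<Rightarrow> 'a set \<Rightarrow> 'a set \<Rightarrow> 'a set"
  where "residual_fractions S A B Q =
    {x \<in> B. \<exists>a\<in>A. \<exists>s\<in>A - Q. Q +>\<^bsub>S\<lparr>carrier := B\<rparr>\<^esub> (s \<otimes>\<^bsub>S\<^esub> x) = Q +>\<^bsub>S\<lparr>carrier := B\<rparr>\<^esub> a}"

context cring
begin

lemma residual_map_residue_fract:
  assumes "subcring A R" "subcring B R" "A \<subseteq> B" "primeideal Q (R\<lparr>carrier := B\<rparr>)" "a \<in> A" "s \<in> A - Q"
  shows "residual_map R B Q (residue_fract (R\<lparr>carrier := A\<rparr>) (Q \<inter> A) a s) =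
    residue_fract (R\<lparr>carrier := B\<rparr>) Q a s"
  using residual_map_fract[OF assms] by (simp add: residue_fract_def)

text \<open>The two cosets modulo \<open>Q\<close> are the values of \<open>quot_map\<close> at the
  two equal cosets modulo \<open>Q \<inter> A\<close>.\<close>

lemma rcos_eq_mono:
  assumes "subcring A R" "subcring B R" "A \<subseteq> B" "primeideal Q (R\<lparr>carrier := B\<rparr>)" "x \<in> A" "y \<in> A"
    and "(Q \<inter> A) +>\<^bsub>R\<lparr>carrier := A\<rparr>\<^esub> x = (Q \<inter> A) +>\<^bsub>R\<lparr>carrier := A\<rparr>\<^esub> y"
  shows "Q +>\<^bsub>R\<lparr>carrier := B\<rparr>\<^esub> x = Q +>\<^bsub>R\<lparr>carrier := B\<rparr>\<^esub> y"
  using quot_map_rcos[OF assms(1-5)] quot_map_rcos[OF assms(1-4,6)] assms(7) by simp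

text \<open>The usual rules for multiplying and adding fractions apply, with common denominator
  \<open>s \<otimes> t\<close>, which stays outside \<open>Q\<close> because \<open>Q\<close> is
  prime.\<close>

lemma residual_fractions_subcring:
  assumes A: "subcring A R" and B: "subcring B R" and AB: "A \<subseteq> B"
    and Q: "primeideal Q (R\<lparr>carrier := B\<rparr>)"
  shows "subcring (residual_fractions R A B Q) R" and "A \<subseteq> residual_fractions R A B Q"
proof -
  let ?B = "R\<lparr>carrier := B\<rparr>" and ?F = "residual_fractions R A B Q"
  interpret q: primeideal Q ?B by (rule Q)
  note clA = subcringE(2,3,5,6,7)[OF A] and clB = subcringE(1,2,3,5,6,7)[OF B]
  have BR: "x \<in> carrier R" if "x \<in> B" for x using that clB by auto
  show sub: "A \<subseteq> ?F"
  proof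
    fix a assume a: "a \<in> A"
    have "\<one> \<in> A - Q" using clA q.one_notin by simp
    moreover have "Q +>\<^bsub>?B\<^esub> (\<one> \<otimes> a) = Q +>\<^bsub>?B\<^esub> a" using a AB BR by auto
    ultimately show "a \<in> ?F" using a AB unfolding residual_fractions_def by blast
  qed
  have both: "x \<otimes> y \<in> ?F \<and> x \<oplus> y \<in> ?F" if x: "x \<in> ?F" and y: "y \<in> ?F" for x y
  proof -
    from x obtain a s where as: "x \<in> B" "a \<in> A" "s \<in> A" "s \<notin> Q"
        "Q +>\<^bsub>?B\<^esub> (s \<otimes> x) = Q +>\<^bsub>?B\<^esub> a"
      by (auto simp: residual_fractions_def)
    from y obtain b t where bt: "y \<in> B" "b \<in> A" "t \<in> A" "t \<notin> Q"
        "Q +>\<^bsub>?B\<^esub> (t \<otimes> y) = Q +>\<^bsub>?B\<^esub> b"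
      by (auto simp: residual_fractions_def)
    have inB: "a \<in> B" "b \<in> B" "s \<in> B" "t \<in> B" using as bt AB by auto
    have inR: "a \<in> carrier R" "b \<in> carrier R" "s \<in> carrier R" "t \<in> carrier R"
      "x \<in> carrier R" "y \<in> carrier R" using inB as bt BR by auto
    have st: "s \<otimes> t \<in> A - Q" using q.mult_notin[of s t] as bt inB clA by auto
    have "Q +>\<^bsub>?B\<^esub> ((s \<otimes> t) \<otimes> (x \<otimes> y)) = Q +>\<^bsub>?B\<^esub> ((s \<otimes> x) \<otimes> (t \<otimes> y))"
      using inR by (simp add: m_ac)
    also have "\<dots> = Q +>\<^bsub>?B\<^esub> (a \<otimes> b)"
      using q.rcos_mult[of "s \<otimes> x" "t \<otimes> y"] q.rcos_mult[of a b] as bt inB clB by simp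
    finally have m: "Q +>\<^bsub>?B\<^esub> ((s \<otimes> t) \<otimes> (x \<otimes> y)) = Q +>\<^bsub>?B\<^esub> (a \<otimes> b)" .
    have "Q +>\<^bsub>?B\<^esub> ((s \<otimes> t) \<otimes> (x \<oplus> y)) = Q +>\<^bsub>?B\<^esub> (t \<otimes> (s \<otimes> x) \<oplus> s \<otimes> (t \<otimes> y))"
      using inR by (simp add: m_ac r_distr)
    also have "\<dots> = Q +>\<^bsub>?B\<^esub> (t \<otimes> a \<oplus> s \<otimes> b)"
      using q.rcos_mult[of t "s \<otimes> x"] q.rcos_mult[of s "t \<otimes> y"] q.rcos_mult[of t a]
        q.rcos_mult[of s b] q.rcos_add[of "t \<otimes> (s \<otimes> x)" "s \<otimes> (t \<otimes> y)"]
        q.rcos_add[of "t \<otimes> a" "s \<otimes> b"] as bt inB clB by simp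
    finally have p: "Q +>\<^bsub>?B\<^esub> ((s \<otimes> t) \<otimes> (x \<oplus> y)) = Q +>\<^bsub>?B\<^esub> (t \<otimes> a \<oplus> s \<otimes> b)" .
    have "a \<otimes> b \<in> A" "t \<otimes> a \<oplus> s \<otimes> b \<in> A" "x \<otimes> y \<in> B" "x \<oplus> y \<in> B"
      using as bt clA clB by auto
    thus ?thesis using st m p unfolding residual_fractions_def by blast
  qed
  have FR: "?F \<subseteq> carrier R" using BR by (auto simp: residual_fractions_def)
  have "subring ?F R"
  proof (rule subringI)
    show "?F \<subseteq> carrier R" by (rule FR)
    show "\<one> \<in> ?F" using sub clA by auto
    fix x assume x: "x \<in> ?F"
    \<comment> \<open>Negation is multiplication by \<open>\<ominus> \<one>\<close>, which already
      lies in \<open>A\<close>.\<close>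
    have "\<ominus> \<one> \<in> ?F" using sub clA by auto
    hence "\<ominus> \<one> \<otimes> x \<in> ?F" using both x by blast
    thus "\<ominus> x \<in> ?F" using x FR by (auto simp: l_minus)
  next
    fix x y assume "x \<in> ?F" "y \<in> ?F"
    thus "x \<otimes> y \<in> ?F" "x \<oplus> y \<in> ?F" using both by auto
  qed
  thus "subcring ?F R" using FR by (intro subcringI) (auto simp: m_comm subset_iff)
qed

text \<open>The residual map is always an injective homomorphism, so only surjectivity is at stake;
  surjectivity can be tested on the fractions \<open>b/1\<close>, since a quotient of two fractions
  over \<open>A\<close> is again one.\<close>

lemma residual_map_iso_iff:
  assumes A: "subcring A R" and B: "subcring B R" and AB: "A \<subseteq> B"
    and Q: "primeideal Q (R\<lparr>carrier := B\<rparr>)"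
  shows "residual_map R B Q \<in> ring_iso (residue_field (R\<lparr>carrier := A\<rparr>) (Q \<inter> A))
      (residue_field (R\<lparr>carrier := B\<rparr>) Q) \<longleftrightarrow> B \<subseteq> residual_fractions R A B Q"
proof -
  let ?A = "R\<lparr>carrier := A\<rparr>" and ?B = "R\<lparr>carrier := B\<rparr>" and ?P = "Q \<inter> A"
  let ?KA = "residue_field ?A ?P" and ?KB = "residue_field ?B Q"
  interpret q: primeideal Q ?B by (rule Q)
  interpret p: primeideal ?P ?A by (rule contracted_prime[OF A B AB Q])
  note clA = subcringE(2,3,5,6,7)[OF A] and clB = subcringE(1,2,3,5,6,7)[OF B]
  have BR: "x \<in> carrier R" if "x \<in> B" for x using that clB by auto
  have nA: "s \<otimes> t \<in> A - Q" if "s \<in> A - Q" "t \<in> A - Q" for s t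
  proof -
    have "s \<in> B" "t \<in> B" "s \<otimes> t \<in> A" using that AB clA by blast+
    thus ?thesis using q.mult_notin[of s t] that by simp
  qed
  note rm = residual_map_residue_fract[OF A B AB Q]
  have KA: "\<exists>a s. a \<in> A \<and> s \<in> A - Q \<and> F = residue_fract ?A ?P a s" if "F \<in> carrier ?KA" for F
    by (rule p.residue_field_cases[OF that]) auto
  have hom: "residual_map R B Q \<in> ring_hom ?KA ?KB"
  proof (rule ring_hom_memI)
    fix F assume "F \<in> carrier ?KA"
    with KA obtain a s where "a \<in> A" "s \<in> A - Q" "F = residue_fract ?A ?P a s" by blast
    moreover from this have "a \<in> B" "s \<in> B" using AB by auto
    ultimately show "residual_map R B Q F \<in> carrier ?KB" by (simp add: rm)
  next
    fix F G assume F: "F \<in> carrier ?KA" and G: "G \<in> carrier ?KA"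
    from KA[OF F] obtain a s where as: "a \<in> A" "s \<in> A - Q" "F = residue_fract ?A ?P a s" by blast
    from KA[OF G] obtain b t where bt: "b \<in> A" "t \<in> A - Q" "G = residue_fract ?A ?P b t" by blast
    have cl: "a \<otimes> b \<in> A" "a \<otimes> t \<oplus> b \<otimes> s \<in> A" using as bt clA by auto
    have inB: "a \<in> B" "b \<in> B" "s \<in> B" "t \<in> B" using as bt AB by auto
    show "residual_map R B Q (F \<otimes>\<^bsub>?KA\<^esub> G) = residual_map R B Q F \<otimes>\<^bsub>?KB\<^esub> residual_map R B Q G"
      using p.residue_field_mult[of a s b t] q.residue_field_mult[of a s b t] as bt cl nA[of s t] inB
      by (simp add: rm)
    show "residual_map R B Q (F \<oplus>\<^bsub>?KA\<^esub> G) = residual_map R B Q F \<oplus>\<^bsub>?KB\<^esub> residual_map R B Q G"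
      using p.residue_field_add[of a s b t] q.residue_field_add[of a s b t] as bt cl nA[of s t] inB
      by (simp add: rm)
  next
    show "residual_map R B Q \<one>\<^bsub>?KA\<^esub> = \<one>\<^bsub>?KB\<^esub>"
      using q.one_notin clA by (simp add: p.residue_field_one q.residue_field_one rm)
  qed
  have inj: "inj_on (residual_map R B Q) (carrier ?KA)"
  proof (rule inj_onI)
    fix F G assume F: "F \<in> carrier ?KA" and G: "G \<in> carrier ?KA"
      and eq: "residual_map R B Q F = residual_map R B Q G"
    from KA[OF F] obtain a s where as: "a \<in> A" "s \<in> A - Q" "F = residue_fract ?A ?P a s" by blast
    from KA[OF G] obtain b t where bt: "b \<in> A" "t \<in> A - Q" "G = residue_fract ?A ?P b t" by blast
    have cl: "a \<otimes> t \<in> A" "b \<otimes> s \<in> A" using as bt clA by auto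
    have inB: "a \<in> B" "b \<in> B" "s \<in> B" "t \<in> B" "a \<otimes> t \<in> B" "b \<otimes> s \<in> B"
      using as bt cl AB by auto
    note inR = inB[THEN BR]
    have "Q +>\<^bsub>?B\<^esub> (a \<otimes> t) = Q +>\<^bsub>?B\<^esub> (b \<otimes> s)"
      using eq q.residue_fract_eq_iff[of a s b t] as bt inB by (simp add: rm)
    moreover have "a \<otimes> t \<in> Q +>\<^bsub>?B\<^esub> (a \<otimes> t)" using q.a_rcos_self[of "a \<otimes> t"] inB by simp
    ultimately obtain z where z: "z \<in> Q" "a \<otimes> t = z \<oplus> b \<otimes> s"
      by (auto simp: a_r_coset_def')
    have zR: "z \<in> carrier R" using z(1) q.a_subset BR by auto
    \<comment> \<open>\<open>z\<close> lies in \<open>Q\<close> and, as a difference of elements of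
      \<open>A\<close>, also in \<open>A\<close>; so the two products agree already modulo
      \<open>Q \<inter> A\<close>.\<close>
    have "z = a \<otimes> t \<ominus> b \<otimes> s" using z(2) zR inR by (simp add: minus_eq a_assoc r_neg)
    hence "z \<in> A" using cl clA by (simp add: minus_eq)
    hence "a \<otimes> t \<in> ?P +>\<^bsub>?A\<^esub> (b \<otimes> s)" using z by (auto simp: a_r_coset_def')
    hence "?P +>\<^bsub>?A\<^esub> (a \<otimes> t) = ?P +>\<^bsub>?A\<^esub> (b \<otimes> s)"
      using p.a_repr_independence'[of "a \<otimes> t" "b \<otimes> s"] cl by simp
    thus "F = G" using p.residue_fract_eq_iff[of a s b t] as bt by auto
  qed
  have surj: "carrier ?KB \<subseteq> residual_map R B Q ` carrier ?KA \<longleftrightarrow> B \<subseteq> residual_fractions R A B Q"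
  proof (intro iffI subsetI)
    fix b assume sub: "carrier ?KB \<subseteq> residual_map R B Q ` carrier ?KA" and b: "b \<in> B"
    have "residue_fract ?B Q b \<one> \<in> carrier ?KB" using b q.one_notin clB by simp
    then obtain F where F: "F \<in> carrier ?KA" "residue_fract ?B Q b \<one> = residual_map R B Q F"
      using sub by blast
    from KA[OF F(1)] obtain a s where as: "a \<in> A" "s \<in> A - Q" "F = residue_fract ?A ?P a s" by blast
    have "Q +>\<^bsub>?B\<^esub> (b \<otimes> s) = Q +>\<^bsub>?B\<^esub> (a \<otimes> \<one>)"
      using F(2) q.residue_fract_eq_iff[of b \<one> a s] as b q.one_notin clB subsetD[OF AB] by (simp add: rm)
    moreover have "b \<otimes> s = s \<otimes> b" "a \<otimes> \<one> = a" using as b AB BR by (auto simp: m_comm)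
    ultimately show "b \<in> residual_fractions R A B Q"
      using as b unfolding residual_fractions_def by auto
  next
    fix G assume sub: "B \<subseteq> residual_fractions R A B Q" and "G \<in> carrier ?KB"
    then obtain b c where bc: "b \<in> B" "c \<in> B" "c \<notin> Q" "G = residue_fract ?B Q b c"
      by (auto elim: q.residue_field_cases)
    from bc sub obtain a s where as: "a \<in> A" "s \<in> A" "s \<notin> Q"
        "Q +>\<^bsub>?B\<^esub> (s \<otimes> b) = Q +>\<^bsub>?B\<^esub> a"
      by (auto simp: residual_fractions_def subset_iff)
    from bc sub obtain d t where dt: "d \<in> A" "t \<in> A" "t \<notin> Q"
        "Q +>\<^bsub>?B\<^esub> (t \<otimes> c) = Q +>\<^bsub>?B\<^esub> d"
      by (auto simp: residual_fractions_def subset_iff)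
    have inB: "a \<in> B" "d \<in> B" "s \<in> B" "t \<in> B" using as dt AB by auto
    have inR: "a \<in> carrier R" "d \<in> carrier R" "s \<in> carrier R" "t \<in> carrier R"
      "b \<in> carrier R" "c \<in> carrier R" using inB bc BR by auto
    \<comment> \<open>The preimage of \<open>b/c\<close> is
      \<open>(a/s)/(d/t) = (a \<otimes> t)/(s \<otimes> d)\<close>. Its denominator is admissible
      because \<open>d\<close> is congruent to \<open>t \<otimes> c\<close>, a product of elements
      outside \<open>Q\<close>.\<close>
    have "t \<otimes> c \<in> B" "t \<otimes> c \<notin> Q" using q.mult_notin[of t c] dt bc inB by auto
    hence dQ: "d \<notin> Q" using q.rcos_eq_zero_iff[of "t \<otimes> c"] q.rcos_eq_zero_iff[of d] dt(4) inB by simp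
    have sd: "s \<otimes> d \<in> A - Q" using nA as dt dQ by auto
    have at: "a \<otimes> t \<in> A" using as dt clA by auto
    have "Q +>\<^bsub>?B\<^esub> ((a \<otimes> t) \<otimes> c) = Q +>\<^bsub>?B\<^esub> (a \<otimes> (t \<otimes> c))" using inR by (simp add: m_ac)
    \<comment> \<open>Both sides are the product of the cosets of \<open>a\<close> and
      \<open>d\<close>.\<close>
    also have "\<dots> = Q +>\<^bsub>?B\<^esub> ((s \<otimes> b) \<otimes> d)"
      using q.rcos_mult[of a "t \<otimes> c"] q.rcos_mult[of "s \<otimes> b" d] as dt inB bc clB by simp
    also have "\<dots> = Q +>\<^bsub>?B\<^esub> (b \<otimes> (s \<otimes> d))" using inR by (simp add: m_ac)
    finally have "residue_fract ?B Q (a \<otimes> t) (s \<otimes> d) = G"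
      using q.residue_fract_eq_iff[of "a \<otimes> t" "s \<otimes> d" b c] at sd bc subsetD[OF AB] by simp
    hence "residual_map R B Q (residue_fract ?A ?P (a \<otimes> t) (s \<otimes> d)) = G"
      using rm at sd by simp
    moreover have "residue_fract ?A ?P (a \<otimes> t) (s \<otimes> d) \<in> carrier ?KA" using at sd by simp
    ultimately show "G \<in> residual_map R B Q ` carrier ?KA" by blast
  qed
  have "residual_map R B Q ` carrier ?KA \<subseteq> carrier ?KB" using ring_hom_closed[OF hom] by blast
  thus ?thesis using hom inj surj unfolding ring_iso_def bij_betw_def by auto
qed

section \<open>Infra-integrality by residual fractions, and change of rings\<close>

text \<open>This trades residue fields for congruences between ring elements; all later arguments
  about infra-integrality go through this form.\<close>

lemma infra_integral_iff:
  assumes "subcring A R" "subcring B R" "A \<subseteq> B"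
  shows "infra_integral R A B \<longleftrightarrow> integral_ext R A B \<and>
    (\<forall>Q. primeideal Q (R\<lparr>carrier := B\<rparr>) \<longrightarrow> B \<subseteq> residual_fractions R A B Q)"
  using residual_map_iso_iff[OF assms] unfolding infra_integral_def by blast

text \<open>The same numerator and denominator serve: a congruence modulo
  \<open>Q \<inter> B\<close> persists modulo \<open>Q\<close>, and an element of \<open>A\<close>
  outside \<open>Q \<inter> B\<close> is outside \<open>Q\<close>.\<close>

lemma residual_fractions_mono:
  assumes A: "subcring A R" and B: "subcring B R" and C: "subcring C R" and AB: "A \<subseteq> B" and BC: "B \<subseteq> C"
    and Q: "primeideal Q (R\<lparr>carrier := C\<rparr>)"
  shows "residual_fractions R A B (Q \<inter> B) \<subseteq> residual_fractions R A C Q"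
proof
  fix x assume "x \<in> residual_fractions R A B (Q \<inter> B)"
  then obtain a s where as: "x \<in> B" "a \<in> A" "s \<in> A" "s \<notin> Q"
    "(Q \<inter> B) +>\<^bsub>R\<lparr>carrier := B\<rparr>\<^esub> (s \<otimes> x) = (Q \<inter> B) +>\<^bsub>R\<lparr>carrier := B\<rparr>\<^esub> a"
    using AB by (auto simp: residual_fractions_def)
  have "s \<otimes> x \<in> B" "a \<in> B" using as AB subcringE(6)[OF B] by auto
  hence "Q +>\<^bsub>R\<lparr>carrier := C\<rparr>\<^esub> (s \<otimes> x) = Q +>\<^bsub>R\<lparr>carrier := C\<rparr>\<^esub> a"
    using rcos_eq_mono[OF B C BC Q] as(5) by blast
  thus "x \<in> residual_fractions R A C Q" using as BC by (auto simp: residual_fractions_def)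
qed

text \<open>Write \<open>x = a/s\<close> with \<open>a = d/v\<close> and \<open>s = c/u\<close>,
  where \<open>c\<close>, \<open>d\<close>, \<open>u\<close>, \<open>v\<close> are in
  \<open>A\<close>; then \<open>x = (u \<otimes> d)/(c \<otimes> v)\<close>.\<close>

lemma residual_fractions_trans:
  assumes A: "subcring A R" and B: "subcring B R" and AB: "A \<subseteq> B"
    and Q: "primeideal Q (R\<lparr>carrier := B\<rparr>)" and A': "A' \<subseteq> residual_fractions R A B Q"
  shows "residual_fractions R A' B Q \<subseteq> residual_fractions R A B Q"
proof
  let ?B = "R\<lparr>carrier := B\<rparr>"
  interpret q: primeideal Q ?B by (rule Q)
  note clA = subcringE(2,3,5,6,7)[OF A] and clB = subcringE(1,2,3,5,6,7)[OF B]
  fix x assume "x \<in> residual_fractions R A' B Q"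
  then obtain a s where as: "x \<in> B" "a \<in> A'" "s \<in> A'" "s \<notin> Q"
      "Q +>\<^bsub>?B\<^esub> (s \<otimes> x) = Q +>\<^bsub>?B\<^esub> a"
    by (auto simp: residual_fractions_def)
  from as A' obtain c u where cu: "s \<in> B" "c \<in> A" "u \<in> A" "u \<notin> Q"
      "Q +>\<^bsub>?B\<^esub> (u \<otimes> s) = Q +>\<^bsub>?B\<^esub> c"
    by (auto simp: residual_fractions_def subset_iff)
  from as A' obtain d v where dv: "a \<in> B" "d \<in> A" "v \<in> A" "v \<notin> Q"
      "Q +>\<^bsub>?B\<^esub> (v \<otimes> a) = Q +>\<^bsub>?B\<^esub> d"
    by (auto simp: residual_fractions_def subset_iff)
  have inB: "c \<in> B" "u \<in> B" "d \<in> B" "v \<in> B" using cu dv AB by auto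
  have inR: "c \<in> carrier R" "u \<in> carrier R" "d \<in> carrier R" "v \<in> carrier R"
    "a \<in> carrier R" "s \<in> carrier R" "x \<in> carrier R" using inB as cu dv clB by auto
  have "u \<otimes> s \<in> B" "u \<otimes> s \<notin> Q" using q.mult_notin[of u s] as cu inB by auto
  \<comment> \<open>\<open>c\<close> is congruent to \<open>u \<otimes> s\<close>, so it may occur
    in a denominator.\<close>
  hence "c \<notin> Q" using q.rcos_eq_zero_iff[of "u \<otimes> s"] q.rcos_eq_zero_iff[of c] cu inB by simp
  hence cv: "c \<otimes> v \<in> A - Q" using q.mult_notin[of c v] cu dv inB clA by auto
  have "Q +>\<^bsub>?B\<^esub> ((c \<otimes> v) \<otimes> x) = Q +>\<^bsub>?B\<^esub> (c \<otimes> (v \<otimes> x))" using inR by (simp add: m_ac)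
  also have "\<dots> = Q +>\<^bsub>?B\<^esub> ((u \<otimes> s) \<otimes> (v \<otimes> x))"
    using q.rcos_mult[of c "v \<otimes> x"] q.rcos_mult[of "u \<otimes> s" "v \<otimes> x"] as cu inB clB by simp
  also have "\<dots> = Q +>\<^bsub>?B\<^esub> ((u \<otimes> v) \<otimes> (s \<otimes> x))" using inR by (simp add: m_ac)
  also have "\<dots> = Q +>\<^bsub>?B\<^esub> ((u \<otimes> v) \<otimes> a)"
    using q.rcos_mult[of "u \<otimes> v" "s \<otimes> x"] q.rcos_mult[of "u \<otimes> v" a] as cu dv inB clB by simp
  also have "\<dots> = Q +>\<^bsub>?B\<^esub> (u \<otimes> (v \<otimes> a))" using inR by (simp add: m_ac)
  also have "\<dots> = Q +>\<^bsub>?B\<^esub> (u \<otimes> d)"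
    using q.rcos_mult[of u "v \<otimes> a"] q.rcos_mult[of u d] dv inB clB by simp
  finally have "Q +>\<^bsub>?B\<^esub> ((c \<otimes> v) \<otimes> x) = Q +>\<^bsub>?B\<^esub> (u \<otimes> d)" .
  moreover have "u \<otimes> d \<in> A" using cu dv clA by auto
  ultimately show "x \<in> residual_fractions R A B Q"
    using cv as(1) unfolding residual_fractions_def by blast
qed

section \<open>Generated subrings\<close>

lemma subset_generate_ring: "H \<subseteq> generate_ring R H"
  by (auto intro: generate_ring.incl)

lemma generate_ring_subcring: "H \<subseteq> carrier R \<Longrightarrow> subcring (generate_ring R H) R"
  using generate_ring_is_subring[of H] generate_ring_incl[of H]
  by (intro subcringI) (auto simp: m_comm subset_iff)

lemma generate_ring_least: "\<lbrakk>subcring K R; H \<subseteq> K\<rbrakk> \<Longrightarrow> generate_ring R H \<subseteq> K"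
  using generate_ring_min_subring1[of H K] subcringE(1)[of K R] by (auto simp: subcring_def)

section \<open>Joins and larger bases of infra-integral extensions\<close>

text \<open>For each prime \<open>Q\<close> of the join, \<open>T\<close> and \<open>B\<close> both
  lie in the subring of residual fractions over \<open>A\<close>, which therefore contains the ring
  they generate. Integrality of the join is a hypothesis because in each use it is inherited from
  the ambient ring.\<close>

lemma infra_integral_join:
  assumes A: "subcring A R" and A': "subcring A' R" and T: "subcring T R" and B: "subcring B R"
    and sub: "A \<subseteq> A'" "A' \<subseteq> T" "A' \<subseteq> B"
    and infT: "infra_integral R A T" and infB: "infra_integral R A' B"
    and int: "integral_ext R A (generate_ring R (T \<union> B))"
  shows "infra_integral R A (generate_ring R (T \<union> B))"
proof -
  define C where "C = generate_ring R (T \<union> B)"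
  have TB: "T \<union> B \<subseteq> carrier R" using subcringE(1)[OF T] subcringE(1)[OF B] by simp
  have C: "subcring C R" using generate_ring_subcring[OF TB] by (simp add: C_def)
  have TC: "T \<subseteq> C" and BC: "B \<subseteq> C" using subset_generate_ring[of "T \<union> B"] by (auto simp: C_def)
  have AT: "A \<subseteq> T" and AC: "A \<subseteq> C" using sub TC by auto
  have "C \<subseteq> residual_fractions R A C Q" if Q: "primeideal Q (R\<lparr>carrier := C\<rparr>)" for Q
  proof -
    have "T \<subseteq> residual_fractions R A T (Q \<inter> T)"
      using infT infra_integral_iff[OF A T AT] contracted_prime[OF T C TC Q] by blast
    hence 1: "T \<subseteq> residual_fractions R A C Q"
      using residual_fractions_mono[OF A T C AT TC Q] by blast
    have "B \<subseteq> residual_fractions R A' B (Q \<inter> B)"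
      using infB infra_integral_iff[OF A' B sub(3)] contracted_prime[OF B C BC Q] by blast
    hence "B \<subseteq> residual_fractions R A' C Q"
      using residual_fractions_mono[OF A' B C sub(3) BC Q] by blast
    \<comment> \<open>As \<open>A'\<close> lies in \<open>T\<close>, fact \<open>1\<close> makes its
      elements fractions over \<open>A\<close>, so fractions over \<open>A'\<close> become fractions
      over \<open>A\<close>.\<close>
    hence "B \<subseteq> residual_fractions R A C Q"
      using residual_fractions_trans[OF A C AC Q, of A'] 1 sub by blast
    with 1 show ?thesis unfolding C_def
      by (intro generate_ring_least residual_fractions_subcring(1)[OF A C AC Q, unfolded C_def]) auto
  qed
  thus ?thesis using int infra_integral_iff[OF A C AC] by (simp add: C_def)
qed

text \<open>A larger base only offers more numerators and denominators.\<close>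

lemma infra_integral_base_mono:
  assumes A: "subcring A R" and A': "subcring A' R" and T: "subcring T R"
    and sub: "A \<subseteq> A'" "A' \<subseteq> T"
    and infT: "infra_integral R A T" and int: "integral_ext R A' T"
  shows "infra_integral R A' T"
proof -
  have "residual_fractions R A T Q \<subseteq> residual_fractions R A' T Q" for Q
    using sub by (auto simp: residual_fractions_def)
  moreover have "A \<subseteq> T" using sub by blast
  ultimately show ?thesis using infra_integral_iff[OF A T] infra_integral_iff[OF A' T sub(2)] infT int
    by blast
qed

lemma infra_integral_refl:
  assumes A: "subcring A R" and int: "integral_ext R A A"
  shows "infra_integral R A A"
  using infra_integral_iff[OF A A] residual_fractions_subcring(2)[OF A A] int by blast

end

lemma integral_ext_mono:
  "\<lbrakk>integral_ext S A B; A \<subseteq> A'; A' \<subseteq> B'; B' \<subseteq> B\<rbrakk> \<Longrightarrow> integral_ext S A' B'"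
  unfolding integral_ext_def by (meson order_trans subsetD)

section \<open>Existence of the t-closure and its stability in subintervals\<close>

text \<open>By FIP the infra-integral subalgebras form a finite family, and \<open>A\<close> belongs
  to it, so it has a maximal member. Closure under joins makes this member greatest.\<close>

lemma (in cring) ex_t_closure:
  assumes A: "subcring A R" and int: "integral_ext R A (carrier R)" and fip: "FIP R A (carrier R)"
  shows "\<exists>T. T \<in> subalgebras R A (carrier R) \<and> infra_integral R A T \<and>
    (\<forall>B \<in> subalgebras R A (carrier R). infra_integral R A B \<longrightarrow> B \<subseteq> T)"
proof -
  let ?I = "{T \<in> subalgebras R A (carrier R). infra_integral R A T}"
  have AR: "A \<subseteq> carrier R" using subcringE(1)[OF A] .
  have "integral_ext R A A" using integral_ext_mono[OF int, of A A] AR by simp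
  hence "A \<in> ?I" using infra_integral_refl[OF A] A AR by (simp add: subalgebras_def)
  moreover have "finite ?I" using fip by (simp add: FIP_def)
  ultimately obtain T where T: "T \<in> ?I" and max: "\<And>B. B \<in> ?I \<Longrightarrow> T \<subseteq> B \<Longrightarrow> T = B"
    using finite_has_maximal[of ?I] by blast
  have "B \<subseteq> T" if B: "B \<in> ?I" for B
  proof -
    let ?C = "generate_ring R (T \<union> B)"
    have TB: "subcring T R" "subcring B R" "A \<subseteq> T" "A \<subseteq> B" "T \<union> B \<subseteq> carrier R"
      using T B by (auto simp: subalgebras_def)
    have C: "subcring ?C R" "T \<union> B \<subseteq> ?C"
      using generate_ring_subcring[OF TB(5)] subset_generate_ring[of "T \<union> B"] by auto
    hence CR: "A \<subseteq> ?C" "?C \<subseteq> carrier R" using TB subcringE(1)[OF C(1)] by auto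
    have "integral_ext R A ?C" using integral_ext_mono[OF int _ CR] by simp
    \<comment> \<open>The join lemma is used with \<open>A\<close> itself as the intermediate
      base.\<close>
    hence "infra_integral R A ?C"
      using infra_integral_join[OF A A TB(1,2) _ TB(3,4)] T B by simp
    hence "?C \<in> ?I" using C CR by (simp add: subalgebras_def)
    from max[OF this] C(2) show ?thesis by blast
  qed
  thus ?thesis using T by blast
qed

text \<open>\<open>GREATEST\<close> carries information only once a greatest element is known to
  exist; \<open>ex_t_closure\<close> provides it.\<close>

lemma (in cring) t_closure_greatest:
  assumes "subcring A R" "integral_ext R A (carrier R)" "FIP R A (carrier R)"
  shows "t_closure R A (carrier R) \<in> subalgebras R A (carrier R)"
    and "infra_integral R A (t_closure R A (carrier R))"
    and "\<lbrakk>B \<in> subalgebras R A (carrier R); infra_integral R A B\<rbrakk> \<Longrightarrow> B \<subseteq> t_closure R A (carrier R)"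
proof -
  obtain T where T: "T \<in> subalgebras R A (carrier R)" "infra_integral R A T"
    and max: "\<And>B. B \<in> subalgebras R A (carrier R) \<Longrightarrow> infra_integral R A B \<Longrightarrow> B \<subseteq> T"
    using ex_t_closure[OF assms] by blast
  have eq: "t_closure R A (carrier R) = T"
    unfolding t_closure_def by (rule Greatest_equality) (use T max in auto)
  show "t_closure R A (carrier R) \<in> subalgebras R A (carrier R)"
    and "infra_integral R A (t_closure R A (carrier R))"
    and "\<lbrakk>B \<in> subalgebras R A (carrier R); infra_integral R A B\<rbrakk> \<Longrightarrow> B \<subseteq> t_closure R A (carrier R)"
    using T max by (simp_all add: eq)
qed

text \<open>\<open>T\<close> stays infra-integral over the larger base \<open>A'\<close>. A
  competitor \<open>B\<close> is given as infra-integral only over \<open>A'\<close>, which is why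
  the join lemma allows a second base: it makes the join of \<open>T\<close> and \<open>B\<close>
  infra-integral over \<open>A\<close>, and maximality of \<open>T\<close> absorbs that
  join.\<close>

lemma (in cring) t_closure_subinterval:
  assumes A: "subcring A R" and int: "integral_ext R A (carrier R)" and fip: "FIP R A (carrier R)"
    and A': "A' \<in> subalgebras R A (t_closure R A (carrier R))"
    and B': "B' \<in> subalgebras R (t_closure R A (carrier R)) (carrier R)"
  shows "t_closure R A' B' = t_closure R A (carrier R)"
proof -
  define T where "T = t_closure R A (carrier R)"
  note T = t_closure_greatest(1,2)[OF A int fip, folded T_def]
    and max = t_closure_greatest(3)[OF A int fip, folded T_def]
  have sT: "subcring T R" and sA': "subcring A' R" and sB': "subcring B' R"
    and sub: "A \<subseteq> A'" "A' \<subseteq> T" "T \<subseteq> B'" "B' \<subseteq> carrier R"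
    using T A' B' by (auto simp: T_def[symmetric] subalgebras_def)
  have "t_closure R A' B' = T"
    unfolding t_closure_def
  proof (rule Greatest_equality)
    have "integral_ext R A' T" using integral_ext_mono[OF int sub(1,2)] sub by simp
    thus "T \<in> subalgebras R A' B' \<and> infra_integral R A' T"
      using infra_integral_base_mono[OF A sA' sT sub(1,2) T(2)] sT sub by (simp add: subalgebras_def)
    fix B assume B: "B \<in> subalgebras R A' B' \<and> infra_integral R A' B"
    let ?C = "generate_ring R (T \<union> B)"
    have sB: "subcring B R" "A' \<subseteq> B" "T \<union> B \<subseteq> carrier R"
      using B sub by (auto simp: subalgebras_def)
    have C: "subcring ?C R" "T \<union> B \<subseteq> ?C"
      using generate_ring_subcring[OF sB(3)] subset_generate_ring[of "T \<union> B"] by auto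
    hence CR: "A \<subseteq> ?C" "?C \<subseteq> carrier R" using sub subcringE(1)[OF C(1)] by auto
    have "integral_ext R A ?C" using integral_ext_mono[OF int _ CR] by simp
    hence "infra_integral R A ?C"
      using infra_integral_join[OF A sA' sT sB(1) sub(1,2) sB(2) T(2)] B by simp
    hence "?C \<subseteq> T" using max C CR by (simp add: subalgebras_def)
    thus "B \<le> T" using C by blast
  qed
  thus ?thesis by (simp add: T_def)
qed

section \<open>Counting the interval by complements\<close>

text \<open>This is a count along the fibres of \<open>?f\<close>, valid for any intermediate ring
  \<open>T\<close>; the t-closure enters only in the final theorem.\<close>

lemma (in cring) card_subalgebras_eq_sum_complements:
  assumes fip: "FIP R A (carrier R)" and T: "T \<in> subalgebras R A (carrier R)"
  shows "card (subalgebras R A (carrier R)) =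
    (\<Sum>(A', B') \<in> subalgebras R A T \<times> subalgebras R T (carrier R). card (complements R A' B' T))"
proof -
  let ?X = "subalgebras R A (carrier R)" and ?Y = "subalgebras R A T \<times> subalgebras R T (carrier R)"
  let ?f = "\<lambda>U. (T \<inter> U, generate_ring R (T \<union> U))"
  have fin: "finite ?X" using fip by (simp add: FIP_def)
  have sub: "subalgebras R A T \<subseteq> ?X" "subalgebras R T (carrier R) \<subseteq> ?X"
    using T by (auto simp: subalgebras_def)
  have fY: "finite ?Y" using fin sub finite_subset by blast
  have Tc: "subcring T R" "A \<subseteq> T" "T \<subseteq> carrier R" using T by (auto simp: subalgebras_def)
  have "?f U \<in> ?Y" if "U \<in> ?X" for U
  proof -
    have U: "subcring U R" "A \<subseteq> U" "T \<union> U \<subseteq> carrier R" using that Tc by (auto simp: subalgebras_def)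
    show ?thesis
      using subcring_inter[OF Tc(1) U(1)] generate_ring_subcring[OF U(3)] subset_generate_ring[of "T \<union> U"]
        subcringE(1)[OF generate_ring_subcring[OF U(3)]] U Tc by (auto simp: subalgebras_def)
  qed
  \<comment> \<open>Grouping the constant summand \<open>1\<close> by the value of \<open>?f\<close>
    turns the cardinality into a sum of fibre sizes.\<close>
  hence "card ?X = (\<Sum>y\<in>?Y. card {U \<in> ?X. ?f U = y})"
    using sum.group[OF fin fY, of ?f "\<lambda>_. 1 :: nat"] by (simp add: image_subset_iff)
  also have "\<dots> = (\<Sum>y\<in>?Y. card (complements R (fst y) (snd y) T))"
  proof (rule sum.cong[OF refl])
    fix y assume "y \<in> ?Y"
    then obtain A' B' where y: "y = (A', B')" "A' \<in> subalgebras R A T" "B' \<in> subalgebras R T (carrier R)"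
      by blast
    \<comment> \<open>A ring \<open>U\<close> with intersection \<open>A'\<close> and join
      \<open>B'\<close> automatically lies between \<open>A'\<close> and \<open>B'\<close>, so the
      fibre can be taken in either interval.\<close>
    have "U \<in> subalgebras R A (carrier R) \<longleftrightarrow> U \<in> subalgebras R A' B'" if "?f U = y" for U
      using that y subset_generate_ring[of "T \<union> U"] unfolding subalgebras_def by auto
    hence "{U \<in> ?X. ?f U = y} = complements R A' B' T"
      using y(1) unfolding complements_def by blast
    thus "card {U \<in> ?X. ?f U = y} = card (complements R (fst y) (snd y) T)" by (simp add: y)
  qed
  finally show ?thesis by (simp add: case_prod_beta)
qed

theorem theorem7p11:
  fixes S :: "('a, 'm) ring_scheme" and R M :: "'a set"
  assumes "cring S" and "subcring R S" and "R \<subset> carrier S"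
    and "local_ring (S\<lparr>carrier := R\<rparr>) M"
    and "integral_ext S R (carrier S)" and "FIP S R (carrier S)"
  shows "card (subalgebras S R (carrier S)) =
    (\<Sum>(R', S') \<in> subalgebras S R (t_closure S R (carrier S)) \<times>
                    subalgebras S (t_closure S R (carrier S)) (carrier S).
       card (complements S R' S' (t_closure S R' S')))"
proof -
  interpret cring S by fact
  show ?thesis
    \<comment> \<open>The count yields complements of the one ring
      \<open>t_closure S R (carrier S)\<close>; on the index set this ring equals each
      \<open>t_closure S R' S'\<close>.\<close>
    unfolding card_subalgebras_eq_sum_complements[OF assms(6) t_closure_greatest(1)[OF assms(2,5,6)]]
    by (rule sum.cong) (auto simp: t_closure_subinterval[OF assms(2,5,6)])
qed

end
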